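(* Let $d>0$, $\alpha>0$, $\gamma>1$. For every $(\theta_0,W_0)\in\Omega_\gamma$ the system $$\dot\theta=G_1(\theta,W),\qquad \dot W=G_2(\theta,W),\qquad (\theta(0),W(0))=(\theta_0,W_0)$$ has a unique solution $(\theta,W)\in C^1(\mathbb{R})\times C^1(\mathbb{R})$ defined for all $t\in\mathbb{R}$ and taking values in $\Omega_\gamma$.
   Context: Fix $d>0$, $\alpha>0$, $\gamma>1$. Let $\theta_\gamma=\operatorname{artanh}(\gamma^{-1/2})$, the unique $\theta>0$ with $\cosh\theta-\gamma^{1/2}\sinh\theta=0$, and $\Omega_\gamma=\{(\theta,W)\in\mathbb{R}^2:\ \theta>0,\ W\in\mathbb{R},\ (\theta,W)\ne(\theta_\gamma,0)\}$. Put $E_\gamma(\theta,W)=\frac{d}{\gamma}(\cosh\theta-\gamma^{1/2}\sinh\theta)^2+W^2$ and $$G_1(\theta,W)=-\frac{\alpha\gamma^{1/2}W}{E_\gamma^{3/2}},\qquad G_2(\theta,W)=-\frac{1}{d^{1/2}}\Big(\frac{\gamma^{3/2}}{\cosh\theta}+\frac{1}{\sinh\theta}\Big)+\frac{\alpha d(\sinh\theta-\gamma^{1/2}\cosh\theta)(\cosh\theta-\gamma^{1/2}\sinh\theta)}{\gamma^{1/2}E_\gamma^{3/2}}.$$ (This models two coaxial circular vortex filaments with vorticities of opposite signs, radii $(d/\gamma)^{1/2}\cosh\theta$, $d^{1/2}\sinh\theta$, axial separation $W$.) *)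

theory Defs
  imports "HOL-Analysis.Analysis"
begin

definition theta_g :: "real \<Rightarrow> real" where
  "theta_g \<gamma> = artanh (1 / sqrt \<gamma>)"

definition Omega_g :: "real \<Rightarrow> (real \<times> real) set" where
  "Omega_g \<gamma> = {(\<theta>, W). \<theta> > 0 \<and> (\<theta>, W) \<noteq> (theta_g \<gamma>, 0)}"

definition E_g :: "real \<Rightarrow> real \<Rightarrow> real \<Rightarrow> real \<Rightarrow> real" where
  "E_g d \<gamma> \<theta> W = d / \<gamma> * (cosh \<theta> - sqrt \<gamma> * sinh \<theta>)\<^sup>2 + W\<^sup>2"

definition G1 :: "real \<Rightarrow> real \<Rightarrow> real \<Rightarrow> real \<Rightarrow> real \<Rightarrow> real" where
  "G1 d \<alpha> \<gamma> \<theta> W = - (\<alpha> * sqrt \<gamma> * W) / (E_g d \<gamma> \<theta> W) powr (3/2)"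

definition G2 :: "real \<Rightarrow> real \<Rightarrow> real \<Rightarrow> real \<Rightarrow> real \<Rightarrow> real" where
  "G2 d \<alpha> \<gamma> \<theta> W =
     - (1 / sqrt d) * (sqrt \<gamma> ^ 3 / cosh \<theta> + 1 / sinh \<theta>)
     + \<alpha> * d * (sinh \<theta> - sqrt \<gamma> * cosh \<theta>) * (cosh \<theta> - sqrt \<gamma> * sinh \<theta>)
       / (sqrt \<gamma> * (E_g d \<gamma> \<theta> W) powr (3/2))"

definition is_solution :: "real \<Rightarrow> real \<Rightarrow> real \<Rightarrow> real \<Rightarrow> real \<Rightarrow> (real \<Rightarrow> real) \<Rightarrow> (real \<Rightarrow> real) \<Rightarrow> bool" where
  "is_solution d \<alpha> \<gamma> \<theta>0 W0 \<theta> W \<longleftrightarrow>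
     (\<forall>t. (\<theta> t, W t) \<in> Omega_g \<gamma>) \<and> \<theta> 0 = \<theta>0 \<and> W 0 = W0 \<and>
     (\<forall>t. (\<theta> has_real_derivative G1 d \<alpha> \<gamma> (\<theta> t) (W t)) (at t)) \<and>
     (\<forall>t. (W has_real_derivative G2 d \<alpha> \<gamma> (\<theta> t) (W t)) (at t)) \<and>
     continuous_on UNIV (deriv \<theta>) \<and> continuous_on UNIV (deriv W)"

end

theory Submission
  imports Defs
begin

text \<open>The system is Hamiltonian with
  \<open>H = \<alpha> \<gamma>\<^sup>1\<^sup>/\<^sup>2 E\<^sup>-\<^sup>1\<^sup>/\<^sup>2 + d\<^sup>-\<^sup>1\<^sup>/\<^sup>2 (\<gamma>\<^sup>3\<^sup>/\<^sup>2 arctan (sinh \<theta>) + ln (tanh (\<theta> / 2)))\<close>.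
  On a level set of \<open>H\<close> both \<open>\<theta>\<close> and \<open>E\<close> are bounded away from \<open>0\<close>: as \<open>\<theta>\<close> tends to \<open>0\<close> the logarithm
  diverges while \<open>E\<close> is bounded below, and then \<open>E\<close> cannot tend to \<open>0\<close> either. Cutting off the singularities
  of \<open>H\<close> below these bounds gives a globally Lipschitz vector field whose solutions are global and conserve
  the modified Hamiltonian. The modified level set obeys the same bounds, so these solutions solve the
  original system; conversely every solution of the original system solves the modified one.\<close>

section \<open>Globally Lipschitz differential equations\<close>

text \<open>The mean value inequality with comparison function \<open>c / K * exp (K * s)\<close>,
  whose value at 0 is nonnegative and is dropped. The gained factor \<open>1 / K\<close> is what
  makes Picard iteration contract.\<close>

lemma primitive_exp_bound_nonneg:
  fixes P :: "real \<Rightarrow> 'a::real_normed_vector"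
  assumes "K > 0" and "\<And>s. (P has_vector_derivative p s) (at s)" and "P 0 = 0"
    and "\<And>s. norm (p s) \<le> c * exp (K * \<bar>s\<bar>)" and "t \<ge> 0"
  shows "norm (P t) \<le> c / K * exp (K * t)"
\<comment> \<open>The mean value inequality requires a nondegenerate interval.\<close>
proof (cases "t = 0")
  case True
  have "0 \<le> norm (p 0)" by simp
  also have "\<dots> \<le> c" using assms(4)[of 0] by simp
  finally show ?thesis using assms True by simp
next
  case False
  have "0 \<le> norm (p 0)" by simp
  also have "\<dots> \<le> c" using assms(4)[of 0] by simp
  finally have c: "c \<ge> 0" .
  have "norm (P t - P 0) \<le> c / K * exp (K * t) - c / K * exp (K * 0)"
  proof (rule differentiable_bound_general[where f' = p and \<phi> = "\<lambda>s. c / K * exp (K * s)"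
        and \<phi>' = "\<lambda>s. c * exp (K * s)"])
    show "continuous_on {0..t} P"
      by (meson assms(2) continuous_at_imp_continuous_on has_vector_derivative_continuous)
    show "((\<lambda>s. c / K * exp (K * s)) has_vector_derivative c * exp (K * x)) (at x)" for x
      unfolding has_real_derivative_iff_has_vector_derivative[symmetric]
      using assms(1) by (auto intro!: derivative_eq_intros)
    show "norm (p x) \<le> c * exp (K * x)" if "0 < x" for x
      using assms(4)[of x] that by simp
  qed (use assms False in \<open>auto intro!: continuous_intros\<close>)
  moreover have "c / K \<ge> 0" using c assms(1) by simp
  ultimately show ?thesis using assms(3) by simp
qed

lemma has_vector_derivative_reflect:
  assumes "(P has_vector_derivative p) (at (- s))"
  shows "((\<lambda>t. P (- t)) has_vector_derivative - p) (at s)"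
proof -
  have "((\<lambda>t::real. - t) has_vector_derivative - 1) (at s)"
    by (auto intro!: derivative_eq_intros)
  from vector_diff_chain_at[OF this assms] show ?thesis by (simp add: o_def)
qed

lemma primitive_exp_bound:
  fixes P :: "real \<Rightarrow> 'a::real_normed_vector"
  assumes "K > 0" and "\<And>s. (P has_vector_derivative p s) (at s)" and "P 0 = 0"
    and "\<And>s. norm (p s) \<le> c * exp (K * \<bar>s\<bar>)"
  shows "norm (P t) \<le> c / K * exp (K * \<bar>t\<bar>)"
proof (cases "t \<ge> 0")
  case True
  then show ?thesis using primitive_exp_bound_nonneg[OF assms, of t] by simp
next
  case False
  have "norm (P (- (- t))) \<le> c / K * exp (K * (- t))"
  proof (rule primitive_exp_bound_nonneg[where P = "\<lambda>s. P (- s)" and p = "\<lambda>s. - p (- s)"])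
    show "((\<lambda>s. P (- s)) has_vector_derivative - p (- s)) (at s)" for s
      by (rule has_vector_derivative_reflect) (rule assms(2))
    show "norm (- p (- s)) \<le> c * exp (K * \<bar>s\<bar>)" for s
      using assms(4)[of "- s"] by simp
  qed (use assms False in auto)
  then show ?thesis using False by simp
qed

text \<open>An antiderivative on the open interval from minus to plus infinity serves both time
  directions at once; adding a constant fixes its value at 0.\<close>

lemma continuous_primitive_exists:
  fixes f :: "real \<Rightarrow> 'a::euclidean_space"
  assumes "continuous_on UNIV f"
  shows "\<exists>P. P 0 = c \<and> (\<forall>t. (P has_vector_derivative f t) (at t))"
proof -
  have "\<exists>F. \<forall>x::real. -\<infinity> < ereal x \<longrightarrow> ereal x < \<infinity> \<longrightarrow> (F has_vector_derivative f x) (at x)"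
    using assms by (intro einterval_antiderivative) (auto simp: continuous_on_eq_continuous_at)
  then obtain F where F: "\<And>x. (F has_vector_derivative f x) (at x)" by auto
  have "((\<lambda>t. F t + (c - F 0)) has_vector_derivative f t) (at t)" for t
    using has_vector_derivative_add_const F by blast
  then show ?thesis by (intro exI[of _ "\<lambda>t. F t + (c - F 0)"]) auto
qed

text \<open>Picard iteration in the norm weighted by \<open>exp (- K * \<bar>t\<bar>)\<close> with \<open>K > L\<close>: there it is a
  contraction on the whole line at once, so no local solutions have to be continued.\<close>

lemma lipschitz_ode_exists:
  fixes F :: "'a::euclidean_space \<Rightarrow> 'a"
  assumes "L-lipschitz_on UNIV F"
  shows "\<exists>x. x 0 = x0 \<and> (\<forall>t. (x has_vector_derivative F (x t)) (at t))"
proof -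
  \<comment> \<open>The factor 2 gives the contraction constant \<open>L / K \<le> 1/2\<close>; the
    summand 1 keeps \<open>K\<close> positive when \<open>L = 0\<close>.\<close>
  define K where "K = 2 * (L + 1)"
  have L: "L \<ge> 0" using assms lipschitz_on_nonneg by blast
  have K: "K > 0" using L by (simp add: K_def)
  have LK: "L / K \<le> 1/2" using L by (simp add: K_def field_simps)
  have lip: "norm (F a - F b) \<le> L * norm (a - b)" for a b
    using lipschitz_onD[OF assms, of a b] by (simp add: dist_norm)
  have contF: "continuous_on UNIV F" using assms lipschitz_on_continuous_on by blast
  \<comment> \<open>The iteration acts on bounded continuous \<open>z\<close>; \<open>y z\<close>
    removes the weight, so the sup norm of \<open>z\<close> is the weighted norm of the candidate
    solution.\<close>
  define y where "y z s = exp (K * \<bar>s\<bar>) *\<^sub>R apply_bcontfun z s" for z :: "real \<Rightarrow>\<^sub>C 'a" and s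
  have "continuous_on UNIV (\<lambda>s. F (y z s))" for z
    unfolding y_def by (rule continuous_on_compose2[OF contF]) (auto intro!: continuous_intros)
  then have "\<forall>z. \<exists>P. P 0 = x0 \<and> (\<forall>t. (P has_vector_derivative F (y z t)) (at t))"
    by (intro allI continuous_primitive_exists)
  then obtain P where P0: "\<And>z. P z 0 = x0"
    and P: "\<And>z t. (P z has_vector_derivative F (y z t)) (at t)"
    by metis
  \<comment> \<open>Growth of order \<open>exp (K * \<bar>t\<bar>)\<close> means that the weighted
    Picard image is bounded again, as the evaluation of \<open>T z\<close> requires.\<close>
  have grow: "norm (P z t - x0) \<le> (norm (F 0) + L * norm z) / K * exp (K * \<bar>t\<bar>)" for z t
  proof (rule primitive_exp_bound[where P = "\<lambda>t. P z t - x0" and p = "\<lambda>t. F (y z t)"])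
    show "((\<lambda>t. P z t - x0) has_vector_derivative F (y z s)) (at s)" for s
      using has_vector_derivative_diff_const P by blast
    show "norm (F (y z s)) \<le> (norm (F 0) + L * norm z) * exp (K * \<bar>s\<bar>)" for s
    proof -
      have "norm (F (y z s)) \<le> norm (F 0) + norm (F (y z s) - F 0)"
        using norm_triangle_sub by blast
      also have "\<dots> \<le> norm (F 0) * 1 + L * norm (y z s)"
        using lip[of "y z s" 0] by simp
      also have "\<dots> \<le> norm (F 0) * exp (K * \<bar>s\<bar>) + L * (exp (K * \<bar>s\<bar>) * norm z)"
      proof (intro add_mono mult_left_mono)
        show "norm (y z s) \<le> exp (K * \<bar>s\<bar>) * norm z"
          unfolding y_def using norm_bounded[of z s] by simp
      qed (use K L in auto)
      finally show ?thesis by (simp add: algebra_simps)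
    qed
  qed (use K P0 in auto)
  define T where "T z = Bcontfun (\<lambda>t. exp (- (K * \<bar>t\<bar>)) *\<^sub>R P z t)" for z
  have T: "apply_bcontfun (T z) t = exp (- (K * \<bar>t\<bar>)) *\<^sub>R P z t" for z t
  proof -
    have "(\<lambda>t. exp (- (K * \<bar>t\<bar>)) *\<^sub>R P z t) \<in> bcontfun"
    proof (rule bcontfun_normI)
      have "continuous_on UNIV (P z)"
        by (meson P continuous_at_imp_continuous_on has_vector_derivative_continuous)
      then show "continuous_on UNIV (\<lambda>t. exp (- (K * \<bar>t\<bar>)) *\<^sub>R P z t)"
        by (intro continuous_intros)
      fix t
      have "norm (P z t) \<le> norm x0 + norm (P z t - x0)" using norm_triangle_sub by blast
      also have "\<dots> \<le> norm x0 * exp (K * \<bar>t\<bar>) + (norm (F 0) + L * norm z) / K * exp (K * \<bar>t\<bar>)"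
        using K mult_left_mono[of 1 "exp (K * \<bar>t\<bar>)" "norm x0"] by (intro add_mono grow) simp
      finally have "exp (- (K * \<bar>t\<bar>)) * norm (P z t) \<le>
          exp (- (K * \<bar>t\<bar>)) * ((norm x0 + (norm (F 0) + L * norm z) / K) * exp (K * \<bar>t\<bar>))"
        by (intro mult_left_mono) (auto simp: algebra_simps)
      also have "\<dots> = norm x0 + (norm (F 0) + L * norm z) / K"
        by (simp add: exp_minus)
      finally show "norm (exp (- (K * \<bar>t\<bar>)) *\<^sub>R P z t) \<le> norm x0 + (norm (F 0) + L * norm z) / K"
        by simp
    qed
    then show ?thesis by (simp add: T_def Bcontfun_inverse)
  qed
  have "dist (T z) (T w) \<le> 1/2 * dist z w" for z w
  proof (rule dist_bound)
    fix t
    have "norm (P z t - P w t) \<le> (L * dist z w) / K * exp (K * \<bar>t\<bar>)"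
    proof (rule primitive_exp_bound[where P = "\<lambda>t. P z t - P w t" and p = "\<lambda>t. F (y z t) - F (y w t)"])
      show "((\<lambda>t. P z t - P w t) has_vector_derivative F (y z s) - F (y w s)) (at s)" for s
        by (intro has_vector_derivative_diff P)
      fix s
      have "norm (F (y z s) - F (y w s)) \<le> L * norm (y z s - y w s)" by (rule lip)
      also have "y z s - y w s = exp (K * \<bar>s\<bar>) *\<^sub>R (apply_bcontfun z s - apply_bcontfun w s)"
        by (simp add: y_def algebra_simps)
      also have "L * norm \<dots> = L * (exp (K * \<bar>s\<bar>) * dist (apply_bcontfun z s) (apply_bcontfun w s))"
        by (simp add: dist_norm)
      also have "\<dots> \<le> L * (exp (K * \<bar>s\<bar>) * dist z w)"
        using L by (intro mult_left_mono dist_bounded) auto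
      finally show "norm (F (y z s) - F (y w s)) \<le> L * dist z w * exp (K * \<bar>s\<bar>)"
        by (simp add: mult_ac)
    qed (use K P0 in auto)
    then have "exp (- (K * \<bar>t\<bar>)) * norm (P z t - P w t) \<le>
        exp (- (K * \<bar>t\<bar>)) * ((L * dist z w) / K * exp (K * \<bar>t\<bar>))"
      by (intro mult_left_mono) auto
    also have "\<dots> = L / K * dist z w" by (simp add: exp_minus)
    also have "\<dots> \<le> 1/2 * dist z w" using LK by (intro mult_right_mono) auto
    finally show "dist (T z t) (T w t) \<le> 1/2 * dist z w"
      by (simp add: T dist_norm flip: scaleR_diff_right)
  qed
  then have "\<exists>!z. T z = z" by (intro banach_fix_type[where c = "1/2"]) auto
  then obtain z where "T z = z" by blast
  \<comment> \<open>At the fixed point the weights cancel, so the derivative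
    \<open>F (y z t)\<close> of \<open>P z\<close> is \<open>F (P z t)\<close>.\<close>
  then have "P z = y z"
    unfolding y_def using T[of z] by (auto simp: fun_eq_iff exp_minus)
  then show ?thesis using P0[of z] P[of z] by auto
qed

text \<open>Gronwall's argument: by Cauchy-Schwarz the squared distance grows at rate at most
  \<open>2 * L\<close>, so multiplied by \<open>exp (- (2 * L * t))\<close> it is nonincreasing, and
  it starts at 0.\<close>

lemma lipschitz_ode_unique_nonneg:
  fixes F :: "'a::real_inner \<Rightarrow> 'a"
  assumes "L-lipschitz_on UNIV F"
    and "\<And>t. (x has_vector_derivative F (x t)) (at t)"
    and "\<And>t. (y has_vector_derivative F (y t)) (at t)"
    and "x 0 = y 0" and "t \<ge> 0"
  shows "x t = y t"
proof -
  have lip: "norm (F a - F b) \<le> L * norm (a - b)" for a b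
    using lipschitz_onD[OF assms(1), of a b] by (simp add: dist_norm)
  define D where "D t = exp (- (2 * L * t)) * ((x t - y t) \<bullet> (x t - y t))" for t
  have "D t \<le> D 0"
  proof (rule DERIV_nonpos_imp_nonincreasing[OF assms(5)])
    fix s
    define e where "e = x s - y s"
    have "((\<lambda>t. x t - y t) has_vector_derivative F (x s) - F (y s)) (at s)"
      by (intro has_vector_derivative_diff assms)
    then have "((\<lambda>t. x t - y t) has_derivative (\<lambda>h. h *\<^sub>R (F (x s) - F (y s)))) (at s)"
      by (simp add: has_vector_derivative_def)
    from has_derivative_inner[OF this this]
    have "((\<lambda>t. (x t - y t) \<bullet> (x t - y t)) has_real_derivative 2 * (e \<bullet> (F (x s) - F (y s)))) (at s)"
      unfolding has_field_derivative_def
      by (rule has_derivative_eq_rhs) (auto simp: e_def inner_commute)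
    moreover have "((\<lambda>t. exp (- (2 * L * t))) has_real_derivative - (2 * L) * exp (- (2 * L * s))) (at s)"
      by (auto intro!: derivative_eq_intros)
    ultimately have deriv: "(D has_real_derivative
        - (2 * L) * exp (- (2 * L * s)) * (e \<bullet> e) +
        2 * (e \<bullet> (F (x s) - F (y s))) * exp (- (2 * L * s))) (at s)"
      unfolding D_def e_def by (intro DERIV_mult)
    have "e \<bullet> (F (x s) - F (y s)) \<le> L * (e \<bullet> e)"
    proof -
      have "e \<bullet> (F (x s) - F (y s)) \<le> norm e * norm (F (x s) - F (y s))"
        by (rule norm_cauchy_schwarz)
      also have "\<dots> \<le> norm e * (L * norm e)"
        using lip by (intro mult_left_mono) (auto simp: e_def)
      finally show ?thesis by (simp add: mult_ac power2_norm_eq_inner flip: power2_eq_square)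
    qed
    then have "2 * exp (- (2 * L * s)) * (e \<bullet> (F (x s) - F (y s)) - L * (e \<bullet> e)) \<le> 0"
      by (intro mult_nonneg_nonpos) auto
    then have "- (2 * L) * exp (- (2 * L * s)) * (e \<bullet> e) +
        2 * (e \<bullet> (F (x s) - F (y s))) * exp (- (2 * L * s)) \<le> 0"
      by argo
    with deriv show "\<exists>r. (D has_real_derivative r) (at s) \<and> r \<le> 0" by blast
  qed
  then have "(x t - y t) \<bullet> (x t - y t) \<le> 0"
    using assms(4) by (simp add: D_def mult_le_0_iff)
  then have "(x t - y t) \<bullet> (x t - y t) = 0" by (intro order.antisym inner_ge_zero)
  then show ?thesis by (simp only: inner_eq_zero_iff) simp
qed

text \<open>Reversing time replaces \<open>F\<close> by \<open>- F\<close>, which has the same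
  Lipschitz constant.\<close>

lemma lipschitz_ode_unique:
  fixes F :: "'a::real_inner \<Rightarrow> 'a"
  assumes "L-lipschitz_on UNIV F"
    and "\<And>t. (x has_vector_derivative F (x t)) (at t)"
    and "\<And>t. (y has_vector_derivative F (y t)) (at t)"
    and "x 0 = y 0"
  shows "x t = y t"
proof (cases "t \<ge> 0")
  case True
  then show ?thesis using lipschitz_ode_unique_nonneg assms by blast
next
  case False
  have "x (- (- t)) = y (- (- t))"
  proof (rule lipschitz_ode_unique_nonneg[where F = "\<lambda>a. - F a" and x = "\<lambda>s. x (- s)" and y = "\<lambda>s. y (- s)"])
    show "L-lipschitz_on UNIV (\<lambda>a. - F a)" using assms(1) by (simp add: lipschitz_on_minus)
  qed (use False assms in \<open>auto intro!: has_vector_derivative_reflect\<close>)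
  then show ?thesis by simp
qed

section \<open>The vector field with its singularities removed\<close>

text \<open>Two branches agreeing to first order at \<open>a\<close> glue differentiably. Each
  branch is tested only on its own closed side, so singularities beyond \<open>a\<close> do no
  harm.\<close>

lemma has_real_derivative_If_ge:
  fixes f g :: "real \<Rightarrow> real"
  assumes "a \<le> x \<Longrightarrow> (f has_real_derivative f' x) (at x)"
    and "x \<le> a \<Longrightarrow> (g has_real_derivative g' x) (at x)"
    and "f a = g a" and "f' a = g' a"
  shows "((\<lambda>x. if a \<le> x then f x else g x) has_real_derivative (if a \<le> x then f' x else g' x)) (at x)"
proof -
  have *: "closure {a..} \<inter> closure {..<a} = {a}" by auto
  have "((\<lambda>x. if x \<in> {a..} then f x else g x) has_derivative
      (if x \<in> {a..} then (*) (f' x) else (*) (g' x))) (at x within ({a..} \<union> {..<a}))"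
  proof (rule has_derivative_If_within_closures[where f' = "\<lambda>x. (*) (f' x)" and g' = "\<lambda>x. (*) (g' x)"])
    show "(f has_derivative (*) (f' x)) (at x within {a..} \<union> closure {a..} \<inter> closure {..<a})"
      if "x \<in> {a..} \<union> closure {a..} \<inter> closure {..<a}"
      using assms(1) that unfolding * by (auto simp: has_field_derivative_def intro: has_derivative_at_withinI)
    show "(g has_derivative (*) (g' x)) (at x within {..<a} \<union> closure {a..} \<inter> closure {..<a})"
      if "x \<in> {..<a} \<union> closure {a..} \<inter> closure {..<a}"
      using assms(2) that unfolding * by (auto simp: has_field_derivative_def intro: has_derivative_at_withinI)
    show "f x = g x" "(*) (f' x) = (*) (g' x)" if "x \<in> closure {a..}" "x \<in> closure {..<a}"
    proof -
      from that * have "x = a" by blast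
      then show "f x = g x" "(*) (f' x) = (*) (g' x)" using assms(3,4) by simp_all
    qed
  qed auto
  moreover have "{a..} \<union> {..<a} = UNIV" by auto
  ultimately show ?thesis
    by (cases "a \<le> x") (simp_all add: has_field_derivative_def)
qed

text \<open>Moving along one coordinate and then the other costs at most \<open>B\<close> times the
  distance each.\<close>

lemma lipschitz_on_pair_if_bounded_partials:
  fixes f :: "real \<times> real \<Rightarrow> real"
  assumes "\<And>x y. ((\<lambda>x. f (x, y)) has_real_derivative fx x y) (at x)"
    and "\<And>x y. ((\<lambda>y. f (x, y)) has_real_derivative fy x y) (at y)"
    and "\<And>x y. \<bar>fx x y\<bar> \<le> B" and "\<And>x y. \<bar>fy x y\<bar> \<le> B"
  shows "(2 * B)-lipschitz_on UNIV f"
proof (rule lipschitz_onI)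
  have B: "0 \<le> B" using assms(3)[of 0 0] by linarith
  then show "0 \<le> 2 * B" by simp
  fix p q :: "real \<times> real"
  obtain x y where p: "p = (x, y)" by (cases p)
  obtain x' y' where q: "q = (x', y')" by (cases q)
  have "\<bar>f (x, y) - f (x', y)\<bar> \<le> B * \<bar>x - x'\<bar>"
    using field_differentiable_bound[of UNIV "\<lambda>x. f (x, y)" "\<lambda>x. fx x y" B x x'] assms(1,3) by simp
  moreover have "\<bar>f (x', y) - f (x', y')\<bar> \<le> B * \<bar>y - y'\<bar>"
    using field_differentiable_bound[of UNIV "\<lambda>y. f (x', y)" "\<lambda>y. fy x' y" B y y'] assms(2,4) by simp
  moreover have "B * \<bar>x - x'\<bar> \<le> B * dist p q" "B * \<bar>y - y'\<bar> \<le> B * dist p q"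
    using B dist_fst_le[of p q] dist_snd_le[of p q]
    by (auto intro!: mult_left_mono simp: p q dist_real_def)
  ultimately show "dist (f p) (f q) \<le> 2 * B * dist p q"
    by (simp add: p q dist_real_def)
qed

text \<open>The powers \<open>E powr (- (3/2))\<close> and \<open>E powr (- (1/2))\<close>, continued below \<open>\<delta>\<close> by their
  first and second order Taylor polynomials at \<open>\<delta>\<close>, so that \<open>chi \<delta>\<close> keeps the derivative
  \<open>- psi \<delta> / 2\<close>.\<close>

definition psi :: "real \<Rightarrow> real \<Rightarrow> real" where
  "psi \<delta> E = (if \<delta> \<le> E then E powr (- (3/2))
     else \<delta> powr (- (3/2)) - 3/2 * \<delta> powr (- (5/2)) * (E - \<delta>))"

definition chi :: "real \<Rightarrow> real \<Rightarrow> real" where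
  "chi \<delta> E = (if \<delta> \<le> E then E powr (- (1/2))
     else \<delta> powr (- (1/2)) - 1/2 * \<delta> powr (- (3/2)) * (E - \<delta>)
       + 3/8 * \<delta> powr (- (5/2)) * (E - \<delta>)\<^sup>2)"

lemma psi_has_derivative:
  assumes "\<delta> > 0"
  shows "(psi \<delta> has_real_derivative - (3/2) * (max \<delta> E) powr (- (5/2))) (at E)"
proof -
  have "(psi \<delta> has_real_derivative
     (if \<delta> \<le> E then - (3/2) * E powr (- (5/2)) else - (3/2) * \<delta> powr (- (5/2)))) (at E)"
    unfolding psi_def[abs_def]
  proof (rule has_real_derivative_If_ge)
    show "((\<lambda>E. E powr (- (3/2))) has_real_derivative - (3/2) * E powr (- (5/2))) (at E)"
      if "\<delta> \<le> E"
      using has_real_derivative_powr[of E "- (3/2)"] assms that by simp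
  qed (auto intro!: derivative_eq_intros)
  then show ?thesis by (cases "\<delta> \<le> E") (simp_all add: max_def)
qed

lemma chi_has_derivative:
  assumes "\<delta> > 0"
  shows "(chi \<delta> has_real_derivative - (1/2) * psi \<delta> E) (at E)"
proof -
  have "(chi \<delta> has_real_derivative
     (if \<delta> \<le> E then - (1/2) * E powr (- (3/2))
     else - (1/2) * \<delta> powr (- (3/2)) + 3/4 * \<delta> powr (- (5/2)) * (E - \<delta>))) (at E)"
    unfolding chi_def[abs_def]
  proof (rule has_real_derivative_If_ge)
    show "((\<lambda>E. E powr (- (1/2))) has_real_derivative - (1/2) * E powr (- (3/2))) (at E)"
      if "\<delta> \<le> E"
      using has_real_derivative_powr[of E "- (1/2)"] assms that by simp
  qed (auto intro!: derivative_eq_intros)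
  then show ?thesis
    by (rule DERIV_cong) (auto simp: psi_def field_simps)
qed

text \<open>Below \<open>\<delta>\<close> both Taylor corrections are nonnegative, so the cut-off
  function still acts as a barrier.\<close>

lemma chi_ge:
  assumes "\<delta> > 0" "E < \<delta>"
  shows "chi \<delta> E \<ge> \<delta> powr (- (1/2))"
proof -
  have "1/2 * \<delta> powr (- (3/2)) * (E - \<delta>) \<le> 0" using assms(2) by (intro mult_nonneg_nonpos) auto
  moreover have "3/8 * \<delta> powr (- (5/2)) * (E - \<delta>)\<^sup>2 \<ge> 0" by simp
  ultimately show ?thesis using assms(2) unfolding chi_def by (smt (verit))
qed

text \<open>Replacing \<open>E\<close> by \<open>max \<delta> E\<close> in the first factor leaves a
  power with exponent \<open>a - r \<le> 0\<close>, largest at \<open>\<delta>\<close>.\<close>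

lemma powr_mult_powr_max_le:
  fixes \<delta> E :: real
  assumes "0 < \<delta>" "0 \<le> E" "0 \<le> a" "a \<le> r"
  shows "E powr a * max \<delta> E powr (- r) \<le> \<delta> powr (a - r)"
proof -
  have "E powr a * max \<delta> E powr (- r) \<le> max \<delta> E powr a * max \<delta> E powr (- r)"
    using assms by (intro mult_right_mono powr_mono2) auto
  also have "\<dots> = max \<delta> E powr (a - r)" by (simp flip: powr_add)
  also have "\<dots> \<le> \<delta> powr (a - r)"
    using assms by (intro powr_mono2') auto
  finally show ?thesis .
qed

text \<open>These are the weighted sizes of \<open>psi\<close> and its derivative that occur in the
  partial derivatives of the field; the decay of the powers absorbs the factors \<open>E\<close> and
  \<open>E^2\<close>.\<close>

lemma psi_bounds:
  assumes "\<delta> > 0"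
  obtains C where "\<And>E. E \<ge> 0 \<Longrightarrow> \<bar>psi \<delta> E\<bar> \<le> C" "\<And>E. E \<ge> 0 \<Longrightarrow> E * \<bar>psi \<delta> E\<bar> \<le> C"
    "\<And>E. E \<ge> 0 \<Longrightarrow> E * (3/2 * max \<delta> E powr (- (5/2))) \<le> C"
    "\<And>E. E \<ge> 0 \<Longrightarrow> E\<^sup>2 * (3/2 * max \<delta> E powr (- (5/2))) \<le> C"
proof -
  define D where "D = \<delta> powr (- (3/2)) + \<delta> powr (- (1/2))"
  \<comment> \<open>The constant is attained at \<open>E = 0\<close>, where the linear continuation
    equals \<open>(1 + 3/2) * \<delta> powr (- (3/2))\<close>.\<close>
  have psi: "\<bar>psi \<delta> E\<bar> \<le> 5/2 * max \<delta> E powr (- (3/2))" if "E \<ge> 0" for E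
  proof (cases "\<delta> \<le> E")
    case True
    then show ?thesis by (simp add: psi_def max_def)
  next
    case False
    have "\<delta> powr (- (5/2)) * (\<delta> - E) \<le> \<delta> powr (- (5/2)) * \<delta> powr 1"
      using assms that by (intro mult_left_mono) auto
    also have "\<dots> = \<delta> powr (- (5/2) + 1)" by (rule powr_add[symmetric])
    also have "\<dots> = \<delta> powr (- (3/2))" by (rule arg_cong[where f = "(powr) \<delta>"]) simp
    finally have "\<delta> powr (- (5/2)) * (\<delta> - E) \<le> \<delta> powr (- (3/2))" .
    moreover have "0 \<le> \<delta> powr (- (5/2)) * (\<delta> - E)" using False by simp
    moreover have "psi \<delta> E = \<delta> powr (- (3/2)) + 3/2 * (\<delta> powr (- (5/2)) * (\<delta> - E))"
      using False by (simp add: psi_def field_simps)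
    moreover have "\<delta> powr (- (3/2)) \<ge> 0" by simp
    moreover have "max \<delta> E powr (- (3/2)) = \<delta> powr (- (3/2))" using False by (simp add: max_def)
    ultimately show ?thesis by linarith
  qed
  show ?thesis
  proof (rule that[of "5/2 * D"])
    fix E :: real assume E: "E \<ge> 0"
    have E2: "E powr 2 = E\<^sup>2" using E by (cases "E = 0") (auto simp: powr_numeral)
    have *: "max \<delta> E powr (- (3/2)) \<le> \<delta> powr (- (3/2))"
      using assms by (intro powr_mono2') auto
    have **: "E * max \<delta> E powr (- (3/2)) \<le> \<delta> powr (- (1/2))"
      using powr_mult_powr_max_le[of \<delta> E 1 "3/2"] assms E by simp
    have 3: "E * max \<delta> E powr (- (5/2)) \<le> \<delta> powr (- (3/2))"
      using powr_mult_powr_max_le[of \<delta> E 1 "5/2"] assms E by simp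
    have 4: "E\<^sup>2 * max \<delta> E powr (- (5/2)) \<le> \<delta> powr (- (1/2))"
      using powr_mult_powr_max_le[of \<delta> E 2 "5/2"] assms E E2 by simp
    have D: "\<delta> powr (- (3/2)) \<le> D" "\<delta> powr (- (1/2)) \<le> D" "0 \<le> D" by (auto simp: D_def)
    show "\<bar>psi \<delta> E\<bar> \<le> 5/2 * D" using psi[OF E] * D by linarith
    have "E * \<bar>psi \<delta> E\<bar> \<le> E * (5/2 * max \<delta> E powr (- (3/2)))"
      by (intro mult_left_mono psi E)
    then show "E * \<bar>psi \<delta> E\<bar> \<le> 5/2 * D" using ** D by linarith
    show "E * (3/2 * max \<delta> E powr (- (5/2))) \<le> 5/2 * D" using 3 D by linarith
    show "E\<^sup>2 * (3/2 * max \<delta> E powr (- (5/2))) \<le> 5/2 * D" using 4 D by linarith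
  qed
qed

text \<open>Although \<open>u\<close> and \<open>v\<close> may grow exponentially,
  \<open>v^2 = u^2 + k\<close> bounds all their products in the partial derivatives by polynomials
  in \<open>u^2 + y^2\<close>, of degree low enough for \<open>psi_bounds\<close>.\<close>

lemma psi_terms_lipschitz:
  fixes u v :: "real \<Rightarrow> real"
  assumes "\<delta> > 0" and "k \<ge> 0"
    and du: "\<And>x. (u has_real_derivative v x) (at x)"
    and dv: "\<And>x. (v has_real_derivative u x) (at x)"
    and uv: "\<And>x. (v x)\<^sup>2 = (u x)\<^sup>2 + k"
  shows "\<exists>L. L-lipschitz_on UNIV (\<lambda>(x, y). y * psi \<delta> ((u x)\<^sup>2 + y\<^sup>2))" (is ?A)
    and "\<exists>L. L-lipschitz_on UNIV (\<lambda>(x, y). u x * v x * psi \<delta> ((u x)\<^sup>2 + y\<^sup>2))" (is ?B)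
proof -
  obtain C where C: "\<And>E. E \<ge> 0 \<Longrightarrow> \<bar>psi \<delta> E\<bar> \<le> C" "\<And>E. E \<ge> 0 \<Longrightarrow> E * \<bar>psi \<delta> E\<bar> \<le> C"
    "\<And>E. E \<ge> 0 \<Longrightarrow> E * (3/2 * max \<delta> E powr (- (5/2))) \<le> C"
    "\<And>E. E \<ge> 0 \<Longrightarrow> E\<^sup>2 * (3/2 * max \<delta> E powr (- (5/2))) \<le> C"
    using psi_bounds[OF assms(1)] by blast
  define e where "e x y = (u x)\<^sup>2 + y\<^sup>2" for x y
  define m where "m x y = 3/2 * max \<delta> (e x y) powr (- (5/2))" for x y
  have e0: "e x y \<ge> 0" for x y by (simp add: e_def)
  have m0: "m x y \<ge> 0" for x y by (simp add: m_def)
  have C0: "C \<ge> 0" using C(1)[of 0] by simp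
  note dpsi = DERIV_chain2[OF psi_has_derivative[OF assms(1)]]
  have dpx: "((\<lambda>x. psi \<delta> ((u x)\<^sup>2 + y\<^sup>2)) has_real_derivative - m x y * (2 * u x * v x)) (at x)" for x y
    unfolding m_def e_def
    by (rule DERIV_cong, rule dpsi) (auto intro!: derivative_eq_intros du)
  have dpy: "((\<lambda>y. psi \<delta> ((u x)\<^sup>2 + y\<^sup>2)) has_real_derivative - m x y * (2 * y)) (at y)" for x y
    unfolding m_def e_def
    by (rule DERIV_cong, rule dpsi) (auto intro!: derivative_eq_intros)
  have em: "e x y * m x y \<le> C" and eem: "(e x y)\<^sup>2 * m x y \<le> C"
    and p: "\<bar>psi \<delta> (e x y)\<bar> \<le> C" and ep: "e x y * \<bar>psi \<delta> (e x y)\<bar> \<le> C" for x y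
    using C[OF e0] by (auto simp: m_def)
  \<comment> \<open>Up to sign this is both the \<open>x\<close>-derivative of the first term and
    the \<open>y\<close>-derivative of the second. The constant \<open>4 + 3 * k\<close> comes from
    the \<open>x\<close>-derivative of the second term and is used for all four.\<close>
  have cross: "\<bar>m x y * (2 * u x * v x * y)\<bar> \<le> C * (4 + 3 * k)" for x y
  proof -
    have "\<bar>2 * u x * y\<bar> \<le> e x y"
      unfolding e_def using sum_squares_bound[of "u x" y] sum_squares_bound[of "- u x" y]
      by (simp add: abs_le_iff)
    moreover have "\<bar>v x\<bar> \<le> 1 + (v x)\<^sup>2"
      using sum_squares_bound[of "\<bar>v x\<bar>" 1] by simp
    then have "\<bar>v x\<bar> \<le> (1 + k) + e x y"
      using zero_le_power2[of y] unfolding e_def uv by linarith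
    ultimately have "\<bar>2 * u x * y\<bar> * \<bar>v x\<bar> \<le> e x y * ((1 + k) + e x y)"
      using e0 by (intro mult_mono) auto
    then have "m x y * (\<bar>2 * u x * y\<bar> * \<bar>v x\<bar>) \<le> m x y * (e x y * ((1 + k) + e x y))"
      by (intro mult_left_mono m0)
    also have "\<dots> = (1 + k) * (e x y * m x y) + (e x y)\<^sup>2 * m x y"
      by (simp add: algebra_simps power2_eq_square)
    also have "\<dots> \<le> (1 + k) * C + C"
      using assms(2) by (intro add_mono mult_left_mono em eem) auto
    also have "\<dots> \<le> C * (4 + 3 * k)" using C0 assms(2) by (simp add: algebra_simps)
    finally show ?thesis using m0 by (simp add: abs_mult mult_ac)
  qed
  have "(2 * (C * (4 + 3 * k)))-lipschitz_on UNIV (\<lambda>(x, y). y * psi \<delta> ((u x)\<^sup>2 + y\<^sup>2))"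
  proof (rule lipschitz_on_pair_if_bounded_partials)
    show "((\<lambda>x. case (x, y) of (x, y) \<Rightarrow> y * psi \<delta> ((u x)\<^sup>2 + y\<^sup>2)) has_real_derivative
      - (m x y * (2 * u x * v x * y))) (at x)" for x y
      by (auto intro!: derivative_eq_intros dpx)
    show "((\<lambda>y. case (x, y) of (x, y) \<Rightarrow> y * psi \<delta> ((u x)\<^sup>2 + y\<^sup>2)) has_real_derivative
      psi \<delta> (e x y) - m x y * (2 * y\<^sup>2)) (at y)" for x y
      unfolding prod.case e_def
      by (rule DERIV_cong, rule DERIV_mult, rule DERIV_ident, rule dpy) (simp add: power2_eq_square)
    show "\<bar>- (m x y * (2 * u x * v x * y))\<bar> \<le> C * (4 + 3 * k)" for x y using cross by simp
    fix x y
    have "m x y * y\<^sup>2 \<le> m x y * e x y" by (intro mult_left_mono m0) (simp add: e_def)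
    then have "m x y * (2 * y\<^sup>2) \<le> 2 * C" using em[of x y] by (simp add: mult_ac)
    moreover have "m x y * (2 * y\<^sup>2) \<ge> 0" using m0 by simp
    ultimately have "\<bar>psi \<delta> (e x y) - m x y * (2 * y\<^sup>2)\<bar> \<le> 3 * C" using p[of x y] by linarith
    also have "\<dots> \<le> C * (4 + 3 * k)" using C0 assms(2) by (simp add: algebra_simps)
    finally show "\<bar>psi \<delta> (e x y) - m x y * (2 * y\<^sup>2)\<bar> \<le> C * (4 + 3 * k)" .
  qed
  then show ?A by blast
  have "(2 * (C * (4 + 3 * k)))-lipschitz_on UNIV (\<lambda>(x, y). u x * v x * psi \<delta> ((u x)\<^sup>2 + y\<^sup>2))"
  proof (rule lipschitz_on_pair_if_bounded_partials)
    show "((\<lambda>x. case (x, y) of (x, y) \<Rightarrow> u x * v x * psi \<delta> ((u x)\<^sup>2 + y\<^sup>2)) has_real_derivative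
      (2 * (u x)\<^sup>2 + k) * psi \<delta> (e x y) - m x y * (2 * (u x)\<^sup>2 * ((u x)\<^sup>2 + k))) (at x)" for x y
    proof -
      have k: "k = v x * v x - u x * u x" using uv[of x] by (simp add: power2_eq_square)
      show ?thesis
        unfolding prod.case e_def
        by (rule DERIV_cong, rule DERIV_mult, rule DERIV_mult, rule du, rule dv, rule dpx)
          (simp add: k power2_eq_square algebra_simps)
    qed
    show "((\<lambda>y. case (x, y) of (x, y) \<Rightarrow> u x * v x * psi \<delta> ((u x)\<^sup>2 + y\<^sup>2)) has_real_derivative
      - (m x y * (2 * u x * v x * y))) (at y)" for x y
      by (auto intro!: derivative_eq_intros dpy simp: e_def)
    show "\<bar>- (m x y * (2 * u x * v x * y))\<bar> \<le> C * (4 + 3 * k)" for x y using cross by simp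
    fix x y
    have ue: "(u x)\<^sup>2 \<le> e x y" by (simp add: e_def)
    have "\<bar>(2 * (u x)\<^sup>2 + k) * psi \<delta> (e x y)\<bar> = (2 * (u x)\<^sup>2 + k) * \<bar>psi \<delta> (e x y)\<bar>"
      using assms(2) by (simp add: abs_mult)
    also have "\<dots> \<le> (2 * e x y + k) * \<bar>psi \<delta> (e x y)\<bar>"
      using ue by (intro mult_right_mono) auto
    also have "\<dots> = 2 * (e x y * \<bar>psi \<delta> (e x y)\<bar>) + k * \<bar>psi \<delta> (e x y)\<bar>"
      by (simp add: algebra_simps)
    also have "\<dots> \<le> 2 * C + k * C"
      using assms(2) by (intro add_mono mult_left_mono ep p) auto
    finally have 1: "\<bar>(2 * (u x)\<^sup>2 + k) * psi \<delta> (e x y)\<bar> \<le> 2 * C + k * C" .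
    have "2 * (u x)\<^sup>2 * ((u x)\<^sup>2 + k) \<le> 2 * e x y * (e x y + k)"
      using ue e0 assms(2) by (intro mult_mono add_mono) auto
    then have "m x y * (2 * (u x)\<^sup>2 * ((u x)\<^sup>2 + k)) \<le> m x y * (2 * e x y * (e x y + k))"
      by (intro mult_left_mono m0)
    also have "\<dots> = 2 * ((e x y)\<^sup>2 * m x y) + 2 * k * (e x y * m x y)"
      by (simp add: algebra_simps power2_eq_square)
    also have "\<dots> \<le> 2 * C + 2 * k * C"
      using assms(2) by (intro add_mono mult_left_mono em eem) auto
    finally have "m x y * (2 * (u x)\<^sup>2 * ((u x)\<^sup>2 + k)) \<le> 2 * C + 2 * k * C" .
    moreover have "m x y * (2 * (u x)\<^sup>2 * ((u x)\<^sup>2 + k)) \<ge> 0" using m0 assms(2) by simp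
    moreover have "(2 * C + k * C) + (2 * C + 2 * k * C) = C * (4 + 3 * k)"
      by (simp add: algebra_simps)
    ultimately show "\<bar>(2 * (u x)\<^sup>2 + k) * psi \<delta> (e x y) - m x y * (2 * (u x)\<^sup>2 * ((u x)\<^sup>2 + k))\<bar>
        \<le> C * (4 + 3 * k)"
      using 1 by linarith
  qed
  then show ?B by blast
qed

section \<open>The part of the Hamiltonian that depends on \<theta> alone\<close>

definition drift :: "real \<Rightarrow> real \<Rightarrow> real \<Rightarrow> real" where
  "drift d \<gamma> \<theta> = 1 / sqrt d * (sqrt \<gamma> ^ 3 / cosh \<theta> + 1 / sinh \<theta>)"

definition Phi :: "real \<Rightarrow> real \<Rightarrow> real \<Rightarrow> real" where
  "Phi d \<gamma> \<theta> = 1 / sqrt d * (sqrt \<gamma> ^ 3 * arctan (sinh \<theta>) + ln (tanh (\<theta> / 2)))"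

text \<open>Below \<open>\<epsilon>\<close> the graph is continued by its tangent, so the derivative
  becomes \<open>drift\<close> frozen at \<open>\<epsilon>\<close>.\<close>

definition Phi_ext :: "real \<Rightarrow> real \<Rightarrow> real \<Rightarrow> real \<Rightarrow> real" where
  "Phi_ext d \<gamma> \<epsilon> \<theta> = (if \<epsilon> \<le> \<theta> then Phi d \<gamma> \<theta> else Phi d \<gamma> \<epsilon> + drift d \<gamma> \<epsilon> * (\<theta> - \<epsilon>))"

text \<open>For positive \<open>d\<close> and \<open>\<gamma>\<close> this is the difference of the
  two filament radii, so that \<open>E_g\<close> is a squared distance; \<open>u_g\<close> and
  \<open>v_g\<close> are derivatives of each other.\<close>

definition u_g :: "real \<Rightarrow> real \<Rightarrow> real \<Rightarrow> real" where
  "u_g d \<gamma> \<theta> = sqrt (d / \<gamma>) * (cosh \<theta> - sqrt \<gamma> * sinh \<theta>)"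

definition v_g :: "real \<Rightarrow> real \<Rightarrow> real \<Rightarrow> real" where
  "v_g d \<gamma> \<theta> = sqrt (d / \<gamma>) * (sinh \<theta> - sqrt \<gamma> * cosh \<theta>)"

text \<open>\<open>arctan (sinh \<theta>)\<close> is the Gudermannian function, a primitive of
  1/cosh; half-angle formulas show that \<open>ln (tanh (\<theta> / 2))\<close> is a primitive of
  1/sinh.\<close>

lemma Phi_has_derivative:
  assumes "\<theta> > 0"
  shows "(Phi d \<gamma> has_real_derivative drift d \<gamma> \<theta>) (at \<theta>)"
proof -
  have t: "tanh (\<theta> / 2) > 0" "sinh (\<theta> / 2) > 0" "cosh (\<theta> / 2) > 0" "sinh \<theta> > 0" "cosh \<theta> > 0"
    using assms by simp_all
  have s: "sinh \<theta> = 2 * sinh (\<theta> / 2) * cosh (\<theta> / 2)" using sinh_double[of "\<theta> / 2"] by simp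
  have c: "(cosh (\<theta> / 2))\<^sup>2 = (sinh (\<theta> / 2))\<^sup>2 + 1" by (rule cosh_square_eq)
  have "1 - (tanh (\<theta> / 2))\<^sup>2 = ((cosh (\<theta> / 2))\<^sup>2 - (sinh (\<theta> / 2))\<^sup>2) / (cosh (\<theta> / 2))\<^sup>2"
    using t by (simp add: tanh_def power_divide diff_divide_distrib)
  also have "\<dots> = 1 / (cosh (\<theta> / 2))\<^sup>2" by (simp add: c)
  finally have t2: "1 - (tanh (\<theta> / 2))\<^sup>2 = 1 / (cosh (\<theta> / 2))\<^sup>2" .
  have 1: "(1 - (tanh (\<theta> / 2))\<^sup>2) * (1 / 2) / tanh (\<theta> / 2) = 1 / sinh \<theta>"
    using t unfolding t2 unfolding s tanh_def by (simp add: power2_eq_square field_simps)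
  have "1 + (sinh \<theta>)\<^sup>2 = (cosh \<theta>)\<^sup>2" by (simp add: cosh_square_eq)
  then have 2: "cosh \<theta> / (1 + (sinh \<theta>)\<^sup>2) = 1 / cosh \<theta>"
    using t by (simp add: power2_eq_square)
  have a: "((\<lambda>\<theta>. arctan (sinh \<theta>)) has_real_derivative 1 / cosh \<theta>) (at \<theta>)"
    by (rule derivative_eq_intros refl)+ (use 2 in \<open>simp add: divide_inverse mult.commute\<close>)
  have "((\<lambda>\<theta>. tanh (\<theta> / 2)) has_real_derivative (1 - (tanh (\<theta> / 2))\<^sup>2) * (1 / 2)) (at \<theta>)"
    using t by (auto intro!: derivative_eq_intros)
  from DERIV_chain2[where f = ln, OF DERIV_ln_divide[OF t(1)] this]
  have b: "((\<lambda>\<theta>. ln (tanh (\<theta> / 2))) has_real_derivative 1 / sinh \<theta>) (at \<theta>)"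
    by (rule DERIV_cong) (simp add: 1[symmetric])
  have "((\<lambda>\<theta>. 1 / sqrt d * (sqrt \<gamma> ^ 3 * arctan (sinh \<theta>) + ln (tanh (\<theta> / 2))))
      has_real_derivative 1 / sqrt d * (sqrt \<gamma> ^ 3 * (1 / cosh \<theta>) + 1 / sinh \<theta>)) (at \<theta>)"
    by (intro DERIV_cmult DERIV_add a b)
  then show ?thesis by (simp add: Phi_def[abs_def] drift_def)
qed

lemma drift_pos:
  assumes "d > 0" "\<gamma> > 0" "\<theta> > 0"
  shows "drift d \<gamma> \<theta> > 0"
  using assms unfolding drift_def by (intro mult_pos_pos add_pos_pos) auto

lemma Phi_mono:
  assumes "d > 0" "\<gamma> > 0" "0 < x" "x \<le> y"
  shows "Phi d \<gamma> x \<le> Phi d \<gamma> y"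
proof (rule DERIV_nonneg_imp_nondecreasing[OF assms(4)])
  fix z assume "x \<le> z"
  then show "\<exists>D. (Phi d \<gamma> has_real_derivative D) (at z) \<and> 0 \<le> D"
    using assms Phi_has_derivative[of z d \<gamma>] drift_pos[of d \<gamma> z] by (intro exI[of _ "drift d \<gamma> z"]) auto
qed

text \<open>The logarithm diverges while the arctangent term converges. This is the barrier at
  \<theta> = 0.\<close>

lemma Phi_at_right_0:
  assumes "d > 0"
  shows "filterlim (Phi d \<gamma>) at_bot (at_right 0)"
proof -
  have "((\<lambda>\<theta>::real. tanh (\<theta> / 2)) \<longlongrightarrow> tanh (0 / 2)) (at_right 0)"
    by (intro tendsto_intros) auto
  moreover have "eventually (\<lambda>\<theta>::real. tanh (\<theta> / 2) \<in> {0<..}) (at_right 0)"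
    using eventually_at_right_less[of "0::real"] by eventually_elim simp
  ultimately have "filterlim (\<lambda>\<theta>::real. tanh (\<theta> / 2)) (at_right 0) (at_right 0)"
    by (intro tendsto_imp_filterlim_at_right) (auto elim!: eventually_mono)
  from filterlim_compose[OF ln_at_0 this]
  have ln: "filterlim (\<lambda>\<theta>. ln (tanh (\<theta> / 2)) :: real) at_bot (at_right 0)" .
  have "((\<lambda>\<theta>. sqrt \<gamma> ^ 3 * arctan (sinh \<theta>)) \<longlongrightarrow> sqrt \<gamma> ^ 3 * arctan (sinh 0)) (at_right 0)"
    by (intro tendsto_intros)
  from iffD2[OF filterlim_tendsto_add_at_bot_iff[OF this] ln]
  have "filterlim (\<lambda>\<theta>. sqrt \<gamma> ^ 3 * arctan (sinh \<theta>) + ln (tanh (\<theta> / 2))) at_bot (at_right 0)" .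
  from filterlim_tendsto_pos_mult_at_bot[OF tendsto_const _ this, of "1 / sqrt d"] assms
  show ?thesis by (simp add: Phi_def[abs_def])
qed

lemma Phi_ext_has_derivative:
  assumes "\<epsilon> > 0"
  shows "(Phi_ext d \<gamma> \<epsilon> has_real_derivative drift d \<gamma> (max \<epsilon> \<theta>)) (at \<theta>)"
proof -
  have "(Phi_ext d \<gamma> \<epsilon> has_real_derivative
     (if \<epsilon> \<le> \<theta> then drift d \<gamma> \<theta> else drift d \<gamma> \<epsilon>)) (at \<theta>)"
    unfolding Phi_ext_def[abs_def]
  proof (rule has_real_derivative_If_ge)
    show "(Phi d \<gamma> has_real_derivative drift d \<gamma> \<theta>) (at \<theta>)" if "\<epsilon> \<le> \<theta>"
      using assms that by (intro Phi_has_derivative) auto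
  qed (auto intro!: derivative_eq_intros)
  then show ?thesis by (cases "\<epsilon> \<le> \<theta>") (simp_all add: max_def)
qed

text \<open>On \<open>{\<epsilon>..}\<close> the derivative of \<open>drift\<close> is bounded,
  since \<open>sinh\<close> stays above \<open>sinh \<epsilon>\<close>; the map
  \<open>max \<epsilon>\<close> is nonexpansive with values in that half-line.\<close>

lemma drift_max_lipschitz:
  assumes "d > 0" "\<gamma> > 0" "\<epsilon> > 0"
  shows "\<exists>L. L-lipschitz_on UNIV (\<lambda>\<theta>. drift d \<gamma> (max \<epsilon> \<theta>))"
proof -
  define B where "B = 1 / sqrt d * (sqrt \<gamma> ^ 3 + (1 / (sinh \<epsilon>)\<^sup>2 + 1 / sinh \<epsilon>))"
  define D where "D x = 1 / sqrt d * (- (sqrt \<gamma> ^ 3 * (sinh x / (cosh x)\<^sup>2)) - cosh x / (sinh x)\<^sup>2)" for x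
  have B: "B \<ge> 0" using assms by (simp add: B_def)
  have "\<bar>drift d \<gamma> x - drift d \<gamma> y\<bar> \<le> B * \<bar>x - y\<bar>" if "x \<in> {\<epsilon>..}" "y \<in> {\<epsilon>..}" for x y
  proof -
    have "norm (drift d \<gamma> x - drift d \<gamma> y) \<le> B * norm (x - y)"
    proof (rule field_differentiable_bound[where S = "{\<epsilon>..}" and f' = D])
      fix x assume "x \<in> {\<epsilon>..}"
      then have x: "\<epsilon> \<le> x" "x > 0" using assms by auto
      then have s: "sinh x > 0" "sinh \<epsilon> > 0" "sinh \<epsilon> \<le> sinh x" using assms by auto
      have "(drift d \<gamma> has_real_derivative D x) (at x)"
        unfolding drift_def[abs_def] D_def using s
        by (intro DERIV_cmult) (auto intro!: derivative_eq_intros simp: power2_eq_square)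
      then show "(drift d \<gamma> has_real_derivative D x) (at x within {\<epsilon>..})"
        by (rule has_field_derivative_at_within)
      have c2: "(cosh x)\<^sup>2 = (sinh x)\<^sup>2 + 1" by (rule cosh_square_eq)
      have "sinh x \<le> (sinh x)\<^sup>2 + 1" using sum_squares_bound[of "sinh x" 1] s(1) unfolding power_one mult_1_right by linarith
      then have 1: "sinh x / (cosh x)\<^sup>2 \<le> 1" unfolding c2 using s
        by (subst divide_le_eq_1_pos) (auto intro: add_nonneg_pos)
      \<comment> \<open>This bounds cosh/sinh^2 by 1/sinh^2 + 1/sinh, which is decreasing; its value
        at \<open>\<epsilon>\<close> enters \<open>B\<close>.\<close>
      have "cosh x \<le> 1 + sinh x"
        by (rule power2_le_imp_le) (use s c2 in \<open>auto simp: power2_sum\<close>)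
      then have "cosh x / (sinh x)\<^sup>2 \<le> (1 + sinh x) / (sinh x)\<^sup>2"
        by (intro divide_right_mono) auto
      also have "\<dots> = 1 / (sinh x)\<^sup>2 + 1 / sinh x"
        using s by (simp add: field_simps power2_eq_square)
      also have "\<dots> \<le> 1 / (sinh \<epsilon>)\<^sup>2 + 1 / sinh \<epsilon>"
        using s by (intro add_mono divide_left_mono power_mono) auto
      finally have 2: "cosh x / (sinh x)\<^sup>2 \<le> 1 / (sinh \<epsilon>)\<^sup>2 + 1 / sinh \<epsilon>" .
      have "sqrt \<gamma> ^ 3 * (sinh x / (cosh x)\<^sup>2) \<le> sqrt \<gamma> ^ 3 * 1"
        using 1 assms by (intro mult_left_mono) auto
      moreover have "0 \<le> sqrt \<gamma> ^ 3 * (sinh x / (cosh x)\<^sup>2)" "0 \<le> cosh x / (sinh x)\<^sup>2"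
        using s assms by auto
      ultimately have "\<bar>- (sqrt \<gamma> ^ 3 * (sinh x / (cosh x)\<^sup>2)) - cosh x / (sinh x)\<^sup>2\<bar>
          \<le> sqrt \<gamma> ^ 3 + (1 / (sinh \<epsilon>)\<^sup>2 + 1 / sinh \<epsilon>)"
        using 2 by linarith
      then have "1 / sqrt d * \<bar>- (sqrt \<gamma> ^ 3 * (sinh x / (cosh x)\<^sup>2)) - cosh x / (sinh x)\<^sup>2\<bar> \<le> B"
        unfolding B_def using assms by (intro mult_left_mono) auto
      then show "norm (D x) \<le> B" using assms by (simp add: D_def abs_mult)
    qed (use that in auto)
    then show ?thesis by simp
  qed
  then have L: "B-lipschitz_on {\<epsilon>..} (drift d \<gamma>)"
    using B by (intro lipschitz_onI) (auto simp: dist_real_def)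
  have "1-lipschitz_on UNIV (max \<epsilon>)"
    by (intro lipschitz_onI) (auto simp: dist_real_def max_def)
  moreover have "range (max \<epsilon>) \<subseteq> {\<epsilon>..}" by auto
  ultimately have "(B * 1)-lipschitz_on UNIV (\<lambda>\<theta>. drift d \<gamma> (max \<epsilon> \<theta>))"
    by (rule lipschitz_on_compose2[OF _ lipschitz_on_subset[OF L]])
  then show ?thesis by blast
qed

section \<open>The squared distance \<open>E_g\<close> and the cut-off field\<close>

lemma E_g_eq:
  assumes "d > 0" "\<gamma> > 0"
  shows "E_g d \<gamma> \<theta> W = (u_g d \<gamma> \<theta>)\<^sup>2 + W\<^sup>2"
  using assms by (simp add: E_g_def u_g_def power_mult_distrib)

lemma u_g_has_derivative: "(u_g d \<gamma> has_real_derivative v_g d \<gamma> \<theta>) (at \<theta>)"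
  unfolding u_g_def[abs_def] v_g_def
  by (auto intro!: derivative_eq_intros)

lemma v_g_has_derivative: "(v_g d \<gamma> has_real_derivative u_g d \<gamma> \<theta>) (at \<theta>)"
  unfolding u_g_def v_g_def[abs_def] by (auto intro!: derivative_eq_intros)

text \<open>By cosh^2 - sinh^2 = 1 the two squares differ by a constant, which serves as
  \<open>k\<close> in \<open>psi_terms_lipschitz\<close> and is positive once
  \<open>\<gamma> > 1\<close>.\<close>

lemma v_g_square:
  assumes "d > 0" "\<gamma> > 0"
  shows "(v_g d \<gamma> \<theta>)\<^sup>2 = (u_g d \<gamma> \<theta>)\<^sup>2 + d / \<gamma> * (\<gamma> - 1)"
proof -
  have "(sinh \<theta> - sqrt \<gamma> * cosh \<theta>)\<^sup>2
      = (cosh \<theta> - sqrt \<gamma> * sinh \<theta>)\<^sup>2 + ((cosh \<theta>)\<^sup>2 - (sinh \<theta>)\<^sup>2) * ((sqrt \<gamma>)\<^sup>2 - 1)"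
    by algebra
  also have "\<dots> = (cosh \<theta> - sqrt \<gamma> * sinh \<theta>)\<^sup>2 + (\<gamma> - 1)"
    using assms by (simp add: cosh_square_eq)
  finally show ?thesis
    using assms by (simp add: u_g_def v_g_def power_mult_distrib distrib_left)
qed

text \<open>The Hamiltonian vector field (dH/dW, -dH/d\<theta>) of H = \<open>\<alpha> * sqrt
  \<gamma> * chi \<delta> (u_g^2 + W^2) + Phi_ext d \<gamma> \<epsilon> \<theta>\<close>.\<close>

definition capped_field :: "real \<Rightarrow> real \<Rightarrow> real \<Rightarrow> real \<Rightarrow> real \<Rightarrow> real \<times> real \<Rightarrow> real \<times> real" where
  "capped_field d \<alpha> \<gamma> \<epsilon> \<delta> = (\<lambda>(\<theta>, W).
     (- (\<alpha> * sqrt \<gamma>) * (W * psi \<delta> ((u_g d \<gamma> \<theta>)\<^sup>2 + W\<^sup>2)),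
      - drift d \<gamma> (max \<epsilon> \<theta>)
        + \<alpha> * sqrt \<gamma> * (u_g d \<gamma> \<theta> * v_g d \<gamma> \<theta> * psi \<delta> ((u_g d \<gamma> \<theta>)\<^sup>2 + W\<^sup>2))))"

lemma capped_field_lipschitz:
  assumes "d > 0" "\<gamma> > 1" "\<epsilon> > 0" "\<delta> > 0"
  shows "\<exists>L. L-lipschitz_on UNIV (capped_field d \<alpha> \<gamma> \<epsilon> \<delta>)"
proof -
  have "\<gamma> > 0" using assms by simp
  note uv = psi_terms_lipschitz[OF assms(4) _ u_g_has_derivative v_g_has_derivative
      v_g_square[OF assms(1) \<open>\<gamma> > 0\<close>]]
  have "0 \<le> d / \<gamma> * (\<gamma> - 1)" using assms by simp
  from uv[OF this] obtain L1 L2 where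
    L1: "L1-lipschitz_on UNIV (\<lambda>(\<theta>, W). W * psi \<delta> ((u_g d \<gamma> \<theta>)\<^sup>2 + W\<^sup>2))" and
    L2: "L2-lipschitz_on UNIV (\<lambda>(\<theta>, W). u_g d \<gamma> \<theta> * v_g d \<gamma> \<theta> * psi \<delta> ((u_g d \<gamma> \<theta>)\<^sup>2 + W\<^sup>2))"
    by blast
  obtain L3 where L3: "L3-lipschitz_on UNIV (\<lambda>\<theta>. drift d \<gamma> (max \<epsilon> \<theta>))"
    using drift_max_lipschitz assms \<open>\<gamma> > 0\<close> by blast
  have "1-lipschitz_on UNIV (fst :: real \<times> real \<Rightarrow> real)"
    by (intro lipschitz_onI) (auto simp: dist_fst_le)
  then have L3': "(L3 * 1)-lipschitz_on UNIV (\<lambda>p::real \<times> real. drift d \<gamma> (max \<epsilon> (fst p)))"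
    by (rule lipschitz_on_compose2) (rule lipschitz_on_subset[OF L3 subset_UNIV])
  have eq: "capped_field d \<alpha> \<gamma> \<epsilon> \<delta> = (\<lambda>p.
     (- (\<alpha> * sqrt \<gamma>) *\<^sub>R (\<lambda>(\<theta>, W). W * psi \<delta> ((u_g d \<gamma> \<theta>)\<^sup>2 + W\<^sup>2)) p,
      - drift d \<gamma> (max \<epsilon> (fst p)) + (\<alpha> * sqrt \<gamma>) *\<^sub>R
        (\<lambda>(\<theta>, W). u_g d \<gamma> \<theta> * v_g d \<gamma> \<theta> * psi \<delta> ((u_g d \<gamma> \<theta>)\<^sup>2 + W\<^sup>2)) p))"
    by (auto simp: capped_field_def fun_eq_iff)
  show ?thesis
    unfolding eq
    using lipschitz_on_Pair[OF lipschitz_on_cmult[OF L1, of "- (\<alpha> * sqrt \<gamma>)"]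
        lipschitz_on_add[OF lipschitz_on_minus[OF L3'] lipschitz_on_cmult[OF L2, of "\<alpha> * sqrt \<gamma>"]]]
    by blast
qed

text \<open>Both cut-offs are inactive under these bounds. This carries solutions between the two
  systems in either direction.\<close>

lemma capped_field_eq:
  assumes "d > 0" "\<gamma> > 0" "\<epsilon> \<le> \<theta>" "\<delta> \<le> E_g d \<gamma> \<theta> W"
  shows "capped_field d \<alpha> \<gamma> \<epsilon> \<delta> (\<theta>, W) = (G1 d \<alpha> \<gamma> \<theta> W, G2 d \<alpha> \<gamma> \<theta> W)"
proof -
  have psi: "psi \<delta> (E_g d \<gamma> \<theta> W) = 1 / E_g d \<gamma> \<theta> W powr (3/2)"
    using assms by (simp add: psi_def powr_minus_divide)
  have g: "sqrt \<gamma> * sqrt \<gamma> = \<gamma>" using assms by simp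
  have "\<alpha> * sqrt \<gamma> * (u_g d \<gamma> \<theta> * v_g d \<gamma> \<theta>) =
      \<alpha> * (sqrt \<gamma> * (sqrt (d / \<gamma>) * sqrt (d / \<gamma>))) *
        ((sinh \<theta> - sqrt \<gamma> * cosh \<theta>) * (cosh \<theta> - sqrt \<gamma> * sinh \<theta>))"
    unfolding u_g_def v_g_def by (simp only: mult_ac)
  moreover have "sqrt \<gamma> * (sqrt (d / \<gamma>) * sqrt (d / \<gamma>)) = d / sqrt \<gamma>"
    using assms g by (simp add: field_simps)
  ultimately have uv: "\<alpha> * sqrt \<gamma> * (u_g d \<gamma> \<theta> * v_g d \<gamma> \<theta>) =
      \<alpha> * (d / sqrt \<gamma>) * ((sinh \<theta> - sqrt \<gamma> * cosh \<theta>) * (cosh \<theta> - sqrt \<gamma> * sinh \<theta>))"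
    by (simp only:)
  have "\<alpha> * sqrt \<gamma> * (u_g d \<gamma> \<theta> * v_g d \<gamma> \<theta> * psi \<delta> (E_g d \<gamma> \<theta> W)) =
      \<alpha> * sqrt \<gamma> * (u_g d \<gamma> \<theta> * v_g d \<gamma> \<theta>) * psi \<delta> (E_g d \<gamma> \<theta> W)" by simp
  also have "\<dots> = \<alpha> * d * (sinh \<theta> - sqrt \<gamma> * cosh \<theta>) * (cosh \<theta> - sqrt \<gamma> * sinh \<theta>)
       / (sqrt \<gamma> * (E_g d \<gamma> \<theta> W) powr (3/2))"
    unfolding uv psi by simp
  finally have 2: "\<alpha> * sqrt \<gamma> * (u_g d \<gamma> \<theta> * v_g d \<gamma> \<theta> * psi \<delta> (E_g d \<gamma> \<theta> W)) = \<dots>" .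
  have "max \<epsilon> \<theta> = \<theta>" using assms by simp
  then show ?thesis
    using 2 psi
    by (simp add: capped_field_def G1_def G2_def drift_def E_g_eq[OF assms(1,2), symmetric])
qed

section \<open>The domain as the set where \<open>E_g\<close> is positive\<close>

lemma tanh_artanh_real:
  fixes x :: real
  assumes "\<bar>x\<bar> < 1"
  shows "tanh (artanh x) = x"
proof -
  define r where "r = (1 + x) / (1 - x)"
  have r: "r > 0" using assms by (auto simp: r_def intro!: divide_pos_pos)
  have "artanh x = ln (sqrt r)" using r by (simp add: artanh_def r_def ln_sqrt)
  then have "tanh (artanh x) = (r - 1) / (r + 1)" using r by (simp add: tanh_ln_real)
  also have "\<dots> = x"
    unfolding r_def using assms by (simp add: field_simps)
  finally show ?thesis .
qed

text \<open>A sum of squares vanishes only if \<open>W = 0\<close> and tanh \<theta> = 1/sqrt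
  \<gamma>. Staying in the domain thus becomes a pair of inequalities, which conservation can
  supply.\<close>

lemma E_g_pos_iff:
  assumes "d > 0" "\<gamma> > 1" "\<theta> > 0"
  shows "E_g d \<gamma> \<theta> W > 0 \<longleftrightarrow> (\<theta>, W) \<in> Omega_g \<gamma>"
proof -
  have g: "sqrt \<gamma> > 1" using assms by simp
  have "cosh \<theta> - sqrt \<gamma> * sinh \<theta> = 0 \<longleftrightarrow> tanh \<theta> = 1 / sqrt \<gamma>"
    using g by (auto simp: tanh_def field_simps)
  also have "\<dots> \<longleftrightarrow> \<theta> = theta_g \<gamma>"
    unfolding theta_g_def using g by (auto simp: tanh_artanh_real artanh_tanh_real dest: sym)
  finally have "E_g d \<gamma> \<theta> W = 0 \<longleftrightarrow> \<theta> = theta_g \<gamma> \<and> W = 0"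
    using assms by (simp add: E_g_def add_nonneg_eq_0_iff)
  moreover have "E_g d \<gamma> \<theta> W \<ge> 0" using assms by (simp add: E_g_def)
  ultimately show ?thesis using assms(3) by (auto simp: Omega_g_def)
qed

section \<open>Conservation of the Hamiltonian\<close>

text \<open>The chain rule terms cancel. Derivatives of \<open>X\<close> and \<open>R\<close> are
  required only along the trajectory, so the statement covers both the cut-off Hamiltonian and the
  singular one.\<close>

lemma hamiltonian_constant:
  fixes \<theta> W X R u v :: "real \<Rightarrow> real"
  assumes u: "\<And>x. (u has_real_derivative v x) (at x)"
    and \<theta>: "\<And>t. (\<theta> has_real_derivative - A * (W t * s t)) (at t)"
    and W: "\<And>t. (W has_real_derivative - b t + A * (u (\<theta> t) * v (\<theta> t) * s t)) (at t)"
    and X: "\<And>t. (X has_real_derivative - (1/2) * s t) (at ((u (\<theta> t))\<^sup>2 + (W t)\<^sup>2))"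
    and R: "\<And>t. (R has_real_derivative b t) (at (\<theta> t))"
  shows "A * X ((u (\<theta> t))\<^sup>2 + (W t)\<^sup>2) + R (\<theta> t) = A * X ((u (\<theta> 0))\<^sup>2 + (W 0)\<^sup>2) + R (\<theta> 0)"
proof (rule DERIV_isconst_all[where f = "\<lambda>t. A * X ((u (\<theta> t))\<^sup>2 + (W t)\<^sup>2) + R (\<theta> t)"], intro allI)
  fix t
  define D\<theta> where "D\<theta> = - A * (W t * s t)"
  define DW where "DW = - b t + A * (u (\<theta> t) * v (\<theta> t) * s t)"
  have dE: "((\<lambda>t. (u (\<theta> t))\<^sup>2 + (W t)\<^sup>2) has_real_derivative
      2 * u (\<theta> t) * (v (\<theta> t) * D\<theta>) + 2 * W t * DW) (at t)"
    by (auto intro!: derivative_eq_intros DERIV_chain2[where f = u and g = \<theta>, OF u] \<theta> W simp: D\<theta>_def DW_def)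
  have "((\<lambda>t. A * X ((u (\<theta> t))\<^sup>2 + (W t)\<^sup>2) + R (\<theta> t)) has_real_derivative
      A * (- (1/2) * s t * (2 * u (\<theta> t) * (v (\<theta> t) * D\<theta>) + 2 * W t * DW)) + b t * D\<theta>) (at t)"
    using DERIV_add[OF DERIV_cmult[OF DERIV_chain2[where f = X, OF X dE], of A]
        DERIV_chain2[where f = R, OF R \<theta>]]
    unfolding D\<theta>_def .
  moreover have "A * (- (1/2) * s t * (2 * u (\<theta> t) * (v (\<theta> t) * D\<theta>) + 2 * W t * DW)) + b t * D\<theta> = 0"
    unfolding D\<theta>_def DW_def by (simp add: algebra_simps)
  ultimately show "((\<lambda>t. A * X ((u (\<theta> t))\<^sup>2 + (W t)\<^sup>2) + R (\<theta> t)) has_real_derivative 0) (at t)"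
    by (rule DERIV_cong)
qed

text \<open>The bounds are stated for any \<open>p\<close>, \<open>r\<close> so that they apply both to the Hamiltonian itself and to
  its extension past \<open>\<epsilon>\<close> and \<open>\<delta>\<close>. The choice of \<open>\<epsilon>\<close> uses that \<open>E_g\<close> is bounded away from \<open>0\<close> for small
  \<open>\<theta>\<close>, where \<open>Phi\<close> tends to minus infinity; then \<open>Phi\<close> is bounded below, which determines \<open>\<delta>\<close>.\<close>

lemma level_set_confined:
  assumes "d > 0" "\<gamma> > 1" "A > 0" "\<theta>0 > 0" "E0 > 0"
  obtains \<epsilon> \<delta> where "\<epsilon> > 0" "\<delta> > 0" "\<epsilon> \<le> \<theta>0" "\<delta> \<le> E0"
    "\<forall>\<theta> W p r. A * p + r = h \<longrightarrow>
      (\<delta> \<le> E_g d \<gamma> \<theta> W \<longrightarrow> p = E_g d \<gamma> \<theta> W powr (- (1/2))) \<longrightarrow>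
      (E_g d \<gamma> \<theta> W < \<delta> \<longrightarrow> \<delta> powr (- (1/2)) \<le> p) \<longrightarrow>
      (\<epsilon> \<le> \<theta> \<longrightarrow> r = Phi d \<gamma> \<theta>) \<longrightarrow> (\<theta> < \<epsilon> \<longrightarrow> r \<le> Phi d \<gamma> \<epsilon>) \<longrightarrow>
      \<epsilon> \<le> \<theta> \<and> \<delta> \<le> E_g d \<gamma> \<theta> W"
proof -
  \<comment> \<open>The bracket in \<open>E_g\<close> equals 1 at \<theta> = 0, so it exceeds 1/2
    nearby and \<open>E_g\<close> is at least \<open>e1\<close> there.\<close>
  define e1 where "e1 = d / \<gamma> * (1/2)\<^sup>2"
  have e1: "e1 > 0" using assms by (simp add: e1_def)
  have "((\<lambda>\<theta>. cosh \<theta> - sqrt \<gamma> * sinh \<theta>) \<longlongrightarrow> cosh 0 - sqrt \<gamma> * sinh 0) (at_right 0)"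
    by (intro tendsto_intros)
  then have "eventually (\<lambda>\<theta>. 1/2 < cosh \<theta> - sqrt \<gamma> * sinh \<theta>) (at_right 0)"
    by (rule order_tendstoD) simp
  moreover have "eventually (\<lambda>\<theta>. Phi d \<gamma> \<theta> < h - A * e1 powr (- (1/2))) (at_right 0)"
    using Phi_at_right_0[OF assms(1)] by (simp add: filterlim_at_bot_dense)
  moreover have "eventually (\<lambda>\<theta>. \<theta> < \<theta>0) (at_right 0)"
    using assms(4) by (rule eventually_at_right_real[THEN eventually_mono]) auto
  moreover have "eventually (\<lambda>\<theta>::real. \<theta> > 0) (at_right 0)" by (rule eventually_at_right_less)
  ultimately have "eventually (\<lambda>\<theta>. 1/2 < cosh \<theta> - sqrt \<gamma> * sinh \<theta> \<and>
      Phi d \<gamma> \<theta> < h - A * e1 powr (- (1/2)) \<and> \<theta> < \<theta>0 \<and> \<theta> > 0) (at_right 0)"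
    by eventually_elim blast
  from eventually_happens'[OF _ this] obtain \<epsilon> where
    eps: "1/2 < cosh \<epsilon> - sqrt \<gamma> * sinh \<epsilon>" "Phi d \<gamma> \<epsilon> < h - A * e1 powr (- (1/2))"
      "\<epsilon> < \<theta>0" "\<epsilon> > 0"
    by auto
  \<comment> \<open>The bracket decreases on the whole line because sqrt \<gamma> > 1. Negative
    \<theta> must be included, as a solution of the cut-off system is not yet known to avoid
    them.\<close>
  have E_small: "e1 \<le> E_g d \<gamma> \<theta> W" if "\<theta> \<le> \<epsilon>" for \<theta> W
  proof -
    have "cosh \<epsilon> - sqrt \<gamma> * sinh \<epsilon> \<le> cosh \<theta> - sqrt \<gamma> * sinh \<theta>"
    proof (rule DERIV_nonpos_imp_nonincreasing[OF that])
      fix x :: real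
      have "((\<lambda>x. cosh x - sqrt \<gamma> * sinh x) has_real_derivative sinh x - sqrt \<gamma> * cosh x) (at x)"
        by (auto intro!: derivative_eq_intros)
      moreover have "1 * cosh x \<le> sqrt \<gamma> * cosh x" using assms by (intro mult_right_mono) auto
      then have "sinh x - sqrt \<gamma> * cosh x \<le> 0" using sinh_less_cosh_real[of x] by linarith
      ultimately show "\<exists>D. ((\<lambda>x. cosh x - sqrt \<gamma> * sinh x) has_real_derivative D) (at x) \<and> D \<le> 0"
        by blast
    qed
    then have "(1/2)\<^sup>2 \<le> (cosh \<theta> - sqrt \<gamma> * sinh \<theta>)\<^sup>2" using eps(1) by (intro power_mono) auto
    then have "d / \<gamma> * (1/2)\<^sup>2 \<le> d / \<gamma> * (cosh \<theta> - sqrt \<gamma> * sinh \<theta>)\<^sup>2"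
      using assms by (intro mult_left_mono) auto
    then show ?thesis unfolding e1_def E_g_def by (rule add_increasing2[rotated]) simp
  qed
  \<comment> \<open>\<open>\<delta> \<le> y powr (- 2)\<close> yields
    \<open>\<delta> powr (- (1/2)) \<ge> y\<close>, so
    \<open>A * \<delta> powr (- (1/2)) + Phi d \<gamma> \<epsilon>\<close> exceeds \<open>h\<close>.
    The 1 in the maximum makes \<open>y\<close> positive.\<close>
  define y where "y = max 1 ((h - Phi d \<gamma> \<epsilon>) / A + 1)"
  define \<delta> where "\<delta> = min E0 (min e1 (y powr (- 2)))"
  have y: "y > 0" by (simp add: y_def)
  have \<delta>: "\<delta> > 0" "\<delta> \<le> E0" "\<delta> \<le> e1" "\<delta> \<le> y powr (- 2)" using y e1 assms by (auto simp: \<delta>_def)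
  have "(y powr (- 2)) powr (- (1/2)) \<le> \<delta> powr (- (1/2))"
    using \<delta> by (intro powr_mono2') auto
  then have "y \<le> \<delta> powr (- (1/2))" using y by (simp add: powr_powr)
  moreover have "(h - Phi d \<gamma> \<epsilon>) / A < y" by (simp add: y_def)
  ultimately have "(h - Phi d \<gamma> \<epsilon>) / A < \<delta> powr (- (1/2))" by linarith
  then have \<delta>_large: "h - Phi d \<gamma> \<epsilon> < A * \<delta> powr (- (1/2))"
    using assms by (simp add: field_simps)
  show ?thesis
  proof (rule that[OF eps(4) \<delta>(1) order.strict_implies_order[OF eps(3)] \<delta>(2)], intro allI impI)
    fix \<theta> W p r
    assume h: "A * p + r = h"
      and p1: "\<delta> \<le> E_g d \<gamma> \<theta> W \<longrightarrow> p = E_g d \<gamma> \<theta> W powr (- (1/2))"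
      and p2: "E_g d \<gamma> \<theta> W < \<delta> \<longrightarrow> \<delta> powr (- (1/2)) \<le> p"
      and r1: "\<epsilon> \<le> \<theta> \<longrightarrow> r = Phi d \<gamma> \<theta>" and r2: "\<theta> < \<epsilon> \<longrightarrow> r \<le> Phi d \<gamma> \<epsilon>"
    have 1: "\<epsilon> \<le> \<theta>"
    proof (rule ccontr)
      assume "\<not> \<epsilon> \<le> \<theta>"
      then have \<theta>: "\<theta> < \<epsilon>" by simp
      have E: "e1 \<le> E_g d \<gamma> \<theta> W" using E_small \<theta> by simp
      \<comment> \<open>Because \<open>\<delta> \<le> e1\<close>, the cut-off in \<open>E_g\<close>
        is inactive for such \<theta>; then \<open>A * p + r\<close> falls short of \<open>h\<close>
        by the choice of \<open>\<epsilon>\<close>.\<close>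
      then have "p = E_g d \<gamma> \<theta> W powr (- (1/2))" using \<delta>(3) p1 by simp
      also have "\<dots> \<le> e1 powr (- (1/2))" using E e1 by (intro powr_mono2') auto
      finally have "A * p \<le> A * e1 powr (- (1/2))" using assms by (intro mult_left_mono) auto
      then show False using h r2[rule_format, OF \<theta>] eps(2) by linarith
    qed
    moreover have "\<delta> \<le> E_g d \<gamma> \<theta> W"
    proof (rule ccontr)
      assume "\<not> \<delta> \<le> E_g d \<gamma> \<theta> W"
      then have "\<delta> powr (- (1/2)) \<le> p" using p2 by simp
      then have "A * \<delta> powr (- (1/2)) \<le> A * p" using assms by (intro mult_left_mono) auto
      moreover have "Phi d \<gamma> \<epsilon> \<le> r" using 1 r1 Phi_mono[of d \<gamma> \<epsilon> \<theta>] assms eps(4) by simp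
      ultimately show False using h \<delta>_large by linarith
    qed
    ultimately show "\<epsilon> \<le> \<theta> \<and> \<delta> \<le> E_g d \<gamma> \<theta> W" ..
  qed
qed

lemma Phi_ext_le:
  assumes "d > 0" "\<gamma> > 0" "\<epsilon> > 0" "\<theta> < \<epsilon>"
  shows "Phi_ext d \<gamma> \<epsilon> \<theta> \<le> Phi d \<gamma> \<epsilon>"
proof -
  have "drift d \<gamma> \<epsilon> * (\<theta> - \<epsilon>) \<le> 0"
    using drift_pos[OF assms(1-3)] assms(4) by (intro mult_nonneg_nonpos) auto
  then show ?thesis using assms(4) by (simp add: Phi_ext_def)
qed

section \<open>Global existence and uniqueness for the original system\<close>

theorem theorem3:
  fixes d \<alpha> \<gamma> \<theta>0 W0 :: real
  assumes "d > 0" and "\<alpha> > 0" and "\<gamma> > 1"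
    and "(\<theta>0, W0) \<in> Omega_g \<gamma>"
  shows "\<exists>\<theta> W. is_solution d \<alpha> \<gamma> \<theta>0 W0 \<theta> W \<and>
           (\<forall>\<theta>' W'. is_solution d \<alpha> \<gamma> \<theta>0 W0 \<theta>' W' \<longrightarrow> \<theta>' = \<theta> \<and> W' = W)"
proof -
  define A where "A = \<alpha> * sqrt \<gamma>"
  define h where "h = A * (E_g d \<gamma> \<theta>0 W0) powr (- (1/2)) + Phi d \<gamma> \<theta>0"
  have A: "A > 0" and \<gamma>: "\<gamma> > 0" using assms by (auto simp: A_def)
  have \<theta>0: "\<theta>0 > 0" using assms(4) by (simp add: Omega_g_def)
  have E0: "E_g d \<gamma> \<theta>0 W0 > 0" using E_g_pos_iff assms \<theta>0 by blast
  note E = E_g_eq[OF assms(1) \<gamma>]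
  obtain \<epsilon> \<delta> where eps: "\<epsilon> > 0" "\<delta> > 0" "\<epsilon> \<le> \<theta>0" "\<delta> \<le> E_g d \<gamma> \<theta>0 W0"
    and confined: "\<forall>\<theta> W p r. A * p + r = h \<longrightarrow>
      (\<delta> \<le> E_g d \<gamma> \<theta> W \<longrightarrow> p = E_g d \<gamma> \<theta> W powr (- (1/2))) \<longrightarrow>
      (E_g d \<gamma> \<theta> W < \<delta> \<longrightarrow> \<delta> powr (- (1/2)) \<le> p) \<longrightarrow>
      (\<epsilon> \<le> \<theta> \<longrightarrow> r = Phi d \<gamma> \<theta>) \<longrightarrow> (\<theta> < \<epsilon> \<longrightarrow> r \<le> Phi d \<gamma> \<epsilon>) \<longrightarrow>
      \<epsilon> \<le> \<theta> \<and> \<delta> \<le> E_g d \<gamma> \<theta> W"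
    by (rule level_set_confined[OF assms(1,3) A \<theta>0 E0, where h = h]) (rule that)
  define F where "F = capped_field d \<alpha> \<gamma> \<epsilon> \<delta>"
  obtain L where L: "L-lipschitz_on UNIV F"
    using capped_field_lipschitz[OF assms(1,3) eps(1,2)] unfolding F_def by blast
  have F_eq: "F (\<theta>, W) = (G1 d \<alpha> \<gamma> \<theta> W, G2 d \<alpha> \<gamma> \<theta> W)"
    if "\<epsilon> \<le> \<theta> \<and> \<delta> \<le> E_g d \<gamma> \<theta> W" for \<theta> W
    unfolding F_def using capped_field_eq[OF assms(1) \<gamma>] that by blast
  obtain z where z0: "z 0 = (\<theta>0, W0)" and z: "\<And>t. (z has_vector_derivative F (z t)) (at t)"
    using lipschitz_ode_exists[OF L] by blast
  define \<theta> where "\<theta> t = fst (z t)" for t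
  define W where "W t = snd (z t)" for t
  have z_eq: "z t = (\<theta> t, W t)" for t by (simp add: \<theta>_def W_def)
  have d\<theta>: "(\<theta> has_real_derivative fst (F (\<theta> t, W t))) (at t)" for t
    using bounded_linear.has_vector_derivative[OF bounded_linear_fst z[of t]]
    by (simp add: \<theta>_def[abs_def] W_def has_real_derivative_iff_has_vector_derivative)
  have dW: "(W has_real_derivative snd (F (\<theta> t, W t))) (at t)" for t
    using bounded_linear.has_vector_derivative[OF bounded_linear_snd z[of t]]
    by (simp add: \<theta>_def W_def[abs_def] has_real_derivative_iff_has_vector_derivative)
  have "A * chi \<delta> ((u_g d \<gamma> (\<theta> t))\<^sup>2 + (W t)\<^sup>2) + Phi_ext d \<gamma> \<epsilon> (\<theta> t) =
      A * chi \<delta> ((u_g d \<gamma> (\<theta> 0))\<^sup>2 + (W 0)\<^sup>2) + Phi_ext d \<gamma> \<epsilon> (\<theta> 0)" for t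
  proof (rule hamiltonian_constant[where u = "u_g d \<gamma>"])
    show "(\<theta> has_real_derivative - A * (W t * psi \<delta> ((u_g d \<gamma> (\<theta> t))\<^sup>2 + (W t)\<^sup>2))) (at t)" for t
      using d\<theta>[of t] by (simp add: F_def capped_field_def A_def)
    show "(W has_real_derivative - drift d \<gamma> (max \<epsilon> (\<theta> t)) + A * (u_g d \<gamma> (\<theta> t) * v_g d \<gamma> (\<theta> t) *
        psi \<delta> ((u_g d \<gamma> (\<theta> t))\<^sup>2 + (W t)\<^sup>2))) (at t)" for t
      using dW[of t] by (simp add: F_def capped_field_def A_def)
  qed (rule u_g_has_derivative chi_has_derivative Phi_ext_has_derivative eps)+
  \<comment> \<open>The initial point satisfies \<open>\<epsilon> \<le> \<theta>0\<close> and
    \<open>\<delta> \<le> E_g d \<gamma> \<theta>0 W0\<close>, so there the cut-off Hamiltonian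
    takes the original value \<open>h\<close>.\<close>
  then have "A * chi \<delta> (E_g d \<gamma> (\<theta> t) (W t)) + Phi_ext d \<gamma> \<epsilon> (\<theta> t) = h" for t
    using eps z0 by (simp add: h_def E \<theta>_def W_def chi_def Phi_ext_def)
  then have conf: "\<epsilon> \<le> \<theta> t \<and> \<delta> \<le> E_g d \<gamma> (\<theta> t) (W t)" for t
  proof (rule confined[rule_format])
    show "chi \<delta> (E_g d \<gamma> (\<theta> t) (W t)) = E_g d \<gamma> (\<theta> t) (W t) powr (- (1/2))"
      if "\<delta> \<le> E_g d \<gamma> (\<theta> t) (W t)" using that by (simp add: chi_def)
    show "Phi_ext d \<gamma> \<epsilon> (\<theta> t) = Phi d \<gamma> (\<theta> t)" if "\<epsilon> \<le> \<theta> t"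
      using that by (simp add: Phi_ext_def)
  qed (use chi_ge Phi_ext_le assms \<gamma> eps in blast)+
  have "is_solution d \<alpha> \<gamma> \<theta>0 W0 \<theta> W"
  proof -
    \<comment> \<open>Continuity of the derivatives is read off from \<open>F\<close> along the
      orbit, which avoids any continuity argument for \<open>G1\<close> and
      \<open>G2\<close>.\<close>
    have contz: "continuous_on UNIV (\<lambda>t. F (\<theta> t, W t))"
    proof (rule continuous_on_compose2[OF lipschitz_on_continuous_on[OF L]])
      show "continuous_on UNIV (\<lambda>t. (\<theta> t, W t))"
        using z unfolding z_eq[symmetric]
        by (meson continuous_at_imp_continuous_on has_vector_derivative_continuous)
    qed simp
    have "deriv \<theta> = (\<lambda>t. fst (F (\<theta> t, W t)))" "deriv W = (\<lambda>t. snd (F (\<theta> t, W t)))"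
      using d\<theta> dW by (auto intro: DERIV_imp_deriv)
    then have "continuous_on UNIV (deriv \<theta>)" "continuous_on UNIV (deriv W)"
      using continuous_on_fst[OF contz] continuous_on_snd[OF contz] by simp_all
    moreover have "(\<theta> t, W t) \<in> Omega_g \<gamma>" for t
      using E_g_pos_iff[of d \<gamma> "\<theta> t" "W t"] assms eps(1,2) conf[of t] by auto
    ultimately show ?thesis
      unfolding is_solution_def using z0 d\<theta> dW F_eq[OF conf] by (simp add: \<theta>_def W_def)
  qed
  moreover have "\<theta>' = \<theta> \<and> W' = W" if sol: "is_solution d \<alpha> \<gamma> \<theta>0 W0 \<theta>' W'" for \<theta>' W'
  proof -
    have \<theta>'_pos: "\<theta>' t > 0" for t using sol by (auto simp: is_solution_def Omega_g_def)
    have E'_pos: "E_g d \<gamma> (\<theta>' t) (W' t) > 0" for t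
      using E_g_pos_iff[of d \<gamma> "\<theta>' t" "W' t"] assms \<theta>'_pos sol by (auto simp: is_solution_def)
    have d\<theta>': "(\<theta>' has_real_derivative G1 d \<alpha> \<gamma> (\<theta>' t) (W' t)) (at t)"
      and dW': "(W' has_real_derivative G2 d \<alpha> \<gamma> (\<theta>' t) (W' t)) (at t)" for t
      using sol by (auto simp: is_solution_def)
    have init: "\<theta>' 0 = \<theta>0" "W' 0 = W0" using sol by (auto simp: is_solution_def)
    \<comment> \<open>With its own argument as threshold, \<open>psi\<close> is exactly the power
      -3/2. Thus \<open>capped_field_eq\<close> with equality in both bounds puts \<open>G1\<close>
      and \<open>G2\<close> into Hamiltonian form before any confinement is known.\<close>
    define s where "s t = psi (E_g d \<gamma> (\<theta>' t) (W' t)) (E_g d \<gamma> (\<theta>' t) (W' t))" for t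
    have G: "(- A * (W' t * s t), - drift d \<gamma> (\<theta>' t) + A * (u_g d \<gamma> (\<theta>' t) * v_g d \<gamma> (\<theta>' t) * s t))
        = (G1 d \<alpha> \<gamma> (\<theta>' t) (W' t), G2 d \<alpha> \<gamma> (\<theta>' t) (W' t))" for t
      using capped_field_eq[OF assms(1) \<gamma> order.refl order.refl, of \<alpha> "\<theta>' t" "W' t"]
      by (simp add: capped_field_def A_def s_def E)
    have "A * ((u_g d \<gamma> (\<theta>' t))\<^sup>2 + (W' t)\<^sup>2) powr (- (1/2)) + Phi d \<gamma> (\<theta>' t) =
        A * ((u_g d \<gamma> (\<theta>' 0))\<^sup>2 + (W' 0)\<^sup>2) powr (- (1/2)) + Phi d \<gamma> (\<theta>' 0)" for t
    proof (rule hamiltonian_constant[where u = "u_g d \<gamma>" and X = "\<lambda>x. x powr (- (1/2))"])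
      fix t
      show "(\<theta>' has_real_derivative - A * (W' t * s t)) (at t)" using d\<theta>'[of t] G[of t] by simp
      show "(W' has_real_derivative - drift d \<gamma> (\<theta>' t) +
          A * (u_g d \<gamma> (\<theta>' t) * v_g d \<gamma> (\<theta>' t) * s t)) (at t)"
        using dW'[of t] G[of t] by simp
      show "((\<lambda>x. x powr (- (1/2))) has_real_derivative - (1/2) * s t)
          (at ((u_g d \<gamma> (\<theta>' t))\<^sup>2 + (W' t)\<^sup>2))"
        using has_real_derivative_powr[OF E'_pos[of t], of "- (1/2)"] by (simp add: s_def psi_def E)
    qed (rule u_g_has_derivative Phi_has_derivative \<theta>'_pos)+
    then have "A * E_g d \<gamma> (\<theta>' t) (W' t) powr (- (1/2)) + Phi d \<gamma> (\<theta>' t) = h" for t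
      using init by (simp add: h_def E)
    \<comment> \<open>The original Hamiltonian meets the same requirements on \<open>p\<close> and
      \<open>r\<close>, by monotonicity of the power and of \<open>Phi\<close>.\<close>
    then have conf': "\<epsilon> \<le> \<theta>' t \<and> \<delta> \<le> E_g d \<gamma> (\<theta>' t) (W' t)" for t
    proof (rule confined[rule_format])
      show "\<delta> powr (- (1/2)) \<le> E_g d \<gamma> (\<theta>' t) (W' t) powr (- (1/2))"
        if "E_g d \<gamma> (\<theta>' t) (W' t) < \<delta>"
        using that E'_pos[of t] by (intro powr_mono2') auto
      show "Phi d \<gamma> (\<theta>' t) \<le> Phi d \<gamma> \<epsilon>" if "\<theta>' t < \<epsilon>"
        using Phi_mono[OF assms(1) \<gamma> \<theta>'_pos] that by simp
    qed simp_all
    \<comment> \<open>Confined by the same \<open>\<epsilon>\<close> and \<open>\<delta>\<close>,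
      the competitor solves the Lipschitz system with the same initial value.\<close>
    have "z t = (\<theta>' t, W' t)" for t
    proof (rule lipschitz_ode_unique[OF L, where y = "\<lambda>t. (\<theta>' t, W' t)"])
      show "((\<lambda>t. (\<theta>' t, W' t)) has_vector_derivative F (\<theta>' t, W' t)) (at t)" for t
        unfolding F_eq[OF conf'] using d\<theta>'[of t] dW'[of t]
        by (intro has_vector_derivative_Pair) (simp_all add: has_real_derivative_iff_has_vector_derivative)
    qed (use z z0 init in auto)
    then show ?thesis by (auto simp: \<theta>_def W_def)
  qed
  ultimately show ?thesis by blast
qed

end
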